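(* Let $\beta$ be a unit-speed timelike curve in $\mathbb{E}^4_1$ with Frenet frame $\{F_1,F_2,F_3,F_4\}$, let $r>0$ be constant, and let $M$ be the tubular hypersurface $$\mathcal{T}(s,t,w)=\beta(s)+r(\cos t\cos w\,F_2(s)+\sin t\cos w\,F_3(s)+\sin w\,F_4(s))$$ in $\mathbb{E}^4_1$, with Gauss map $N=-(\cos t\cos w\,F_2+\sin t\cos w\,F_3+\sin w\,F_4)$. Then $M$ cannot have $\mathcal{L}_1$-harmonic Gauss map; that is, $\mathcal{L}_1N=0$ does not hold (identically) on $M$.
   Context: $\mathbb{E}^4_1$ is $\mathbb{R}^4$ with the metric $\langle\ ,\ \rangle=-dx_1^2+dx_2^2+dx_3^2+dx_4^2$. The curve $\beta:I\to\mathbb{E}^4_1$ ($I$ an open interval) is smooth with $\beta'=F_1$, and $\{F_1,F_2,F_3,F_4\}$ is a smooth orthonormal frame along $\beta$ with $\langle F_1,F_1\rangle=-1$, $\langle F_i,F_i\rangle=1$ ($i=2,3,4$), satisfying the Frenet equations $F_1'=k_1F_2$, $F_2'=k_1F_1+k_2F_3$, $F_3'=-k_2F_2+k_3F_4$, $F_4'=-k_3F_3$, where $k_1,k_2,k_3$ are smooth functions of $s$ (the curvatures of $\beta$). The parameters $(s,t,w)$ range over a (nonempty) connected open set $U\subset I\times\mathbb{R}^2$ projecting onto $I$ on which $\mathcal{T}$ is an immersion, i.e. $\cos w\neq0$ and $1+rk_1\cos t\cos w\neq0$. The unit normal $N$ has $\varepsilon=\langle N,N\rangle=1$, and the principal curvatures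 with respect to $N$ (eigenvalues of the shape operator $-dN$) are $\kappa_1=\kappa_2=\frac1r$, $\kappa_3=\frac{k_1\cos t\cos w}{1+rk_1\cos t\cos w}$. Operator $\mathcal{L}_1$ (Cheng–Yau) on the Gauss map: put $a_1=-\sum_i\kappa_i$, $a_k=(-1)^k\sum_{i_1<\dots<i_k}\kappa_{i_1}\cdots\kappa_{i_k}$ ($k=2,3$), and define $H_k$ by $\binom{3}{k}H_k=(-\varepsilon)^ka_k$. Then $$\mathcal{L}_1N=-\varepsilon\,\mathfrak{C}_1\big(\nabla H_2+(3H_1H_2-H_3)N\big),\qquad \mathfrak{C}_1=\binom32(-\varepsilon)=-3\varepsilon,$$ where $\nabla$ is the gradient on $M$ with respect to the induced metric, viewed as an $\mathbb{E}^4_1$-valued map. *)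

theory Defs
  imports "HOL-Analysis.Analysis"
begin

definition mink :: "real^4 \<Rightarrow> real^4 \<Rightarrow> real" where
  "mink x y = - (x$1 * y$1) + x$2 * y$2 + x$3 * y$3 + x$4 * y$4"

definition smooth_on :: "real set \<Rightarrow> (real \<Rightarrow> 'a::real_normed_vector) \<Rightarrow> bool" where
  "smooth_on I f \<longleftrightarrow>
     (\<forall>n. \<forall>s\<in>I. ((\<lambda>g x. vector_derivative g (at x)) ^^ n) f differentiable (at s))"

definition orthonormal_frame :: "real^4 \<Rightarrow> real^4 \<Rightarrow> real^4 \<Rightarrow> real^4 \<Rightarrow> bool" where
  "orthonormal_frame e1 e2 e3 e4 \<longleftrightarrow>
     mink e1 e1 = -1 \<and> mink e2 e2 = 1 \<and> mink e3 e3 = 1 \<and> mink e4 e4 = 1 \<and>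
     mink e1 e2 = 0 \<and> mink e1 e3 = 0 \<and> mink e1 e4 = 0 \<and>
     mink e2 e3 = 0 \<and> mink e2 e4 = 0 \<and> mink e3 e4 = 0"

definition timelike_frenet_curve ::
  "real set \<Rightarrow> (real \<Rightarrow> real^4) \<Rightarrow> (real \<Rightarrow> real^4) \<Rightarrow> (real \<Rightarrow> real^4) \<Rightarrow> (real \<Rightarrow> real^4) \<Rightarrow>
   (real \<Rightarrow> real^4) \<Rightarrow> (real \<Rightarrow> real) \<Rightarrow> (real \<Rightarrow> real) \<Rightarrow> (real \<Rightarrow> real) \<Rightarrow> bool" where
  "timelike_frenet_curve I \<beta> F1 F2 F3 F4 k1 k2 k3 \<longleftrightarrow>
     open I \<and> is_interval I \<and>
     smooth_on I \<beta> \<and> smooth_on I F1 \<and> smooth_on I F2 \<and> smooth_on I F3 \<and> smooth_on I F4 \<and>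
     smooth_on I k1 \<and> smooth_on I k2 \<and> smooth_on I k3 \<and>
     (\<forall>s\<in>I. orthonormal_frame (F1 s) (F2 s) (F3 s) (F4 s)) \<and>
     (\<forall>s\<in>I. (\<beta> has_vector_derivative F1 s) (at s)) \<and>
     (\<forall>s\<in>I. (F1 has_vector_derivative k1 s *\<^sub>R F2 s) (at s)) \<and>
     (\<forall>s\<in>I. (F2 has_vector_derivative k1 s *\<^sub>R F1 s + k2 s *\<^sub>R F3 s) (at s)) \<and>
     (\<forall>s\<in>I. (F3 has_vector_derivative - k2 s *\<^sub>R F2 s + k3 s *\<^sub>R F4 s) (at s)) \<and>
     (\<forall>s\<in>I. (F4 has_vector_derivative - k3 s *\<^sub>R F3 s) (at s))"

text \<open>The hypersurface and its Gauss map are maps of the parameter point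
  \<open>p = (s, t, w)\<close>, with \<open>s = p$1\<close>, \<open>t = p$2\<close>, \<open>w = p$3\<close>.\<close>

definition tube_dir ::
  "(real \<Rightarrow> real^4) \<Rightarrow> (real \<Rightarrow> real^4) \<Rightarrow> (real \<Rightarrow> real^4) \<Rightarrow> real^3 \<Rightarrow> real^4" where
  "tube_dir F2 F3 F4 p =
     (cos (p$2) * cos (p$3)) *\<^sub>R F2 (p$1) + (sin (p$2) * cos (p$3)) *\<^sub>R F3 (p$1)
       + sin (p$3) *\<^sub>R F4 (p$1)"

definition tube ::
  "real \<Rightarrow> (real \<Rightarrow> real^4) \<Rightarrow> (real \<Rightarrow> real^4) \<Rightarrow> (real \<Rightarrow> real^4) \<Rightarrow> (real \<Rightarrow> real^4) \<Rightarrow>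
   real^3 \<Rightarrow> real^4" where
  "tube r \<beta> F2 F3 F4 p = \<beta> (p$1) + r *\<^sub>R tube_dir F2 F3 F4 p"

definition tube_normal ::
  "(real \<Rightarrow> real^4) \<Rightarrow> (real \<Rightarrow> real^4) \<Rightarrow> (real \<Rightarrow> real^4) \<Rightarrow> real^3 \<Rightarrow> real^4" where
  "tube_normal F2 F3 F4 p = - tube_dir F2 F3 F4 p"

text \<open>Geometry of a hypersurface \<open>X\<close> with unit normal field \<open>N\<close>, pulled back to the
  parameter domain: a tangent vector at \<open>X p\<close> is represented by the \<open>u\<close> with image
  \<open>dX\<^sub>p u\<close>. The descriptions below are meaningful where \<open>X\<close> is an immersion with
  nondegenerate induced metric.\<close>

abbreviation D :: "(real^3 \<Rightarrow> 'a::real_normed_vector) \<Rightarrow> real^3 \<Rightarrow> real^3 \<Rightarrow> 'a" where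
  "D f p u \<equiv> frechet_derivative f (at p) u"

definition immersion_on :: "(real^3) set \<Rightarrow> (real^3 \<Rightarrow> real^4) \<Rightarrow> bool" where
  "immersion_on U X \<longleftrightarrow> (\<forall>p\<in>U. X differentiable (at p) \<and> inj (D X p))"

definition induced_metric :: "(real^3 \<Rightarrow> real^4) \<Rightarrow> real^3 \<Rightarrow> real^3 \<Rightarrow> real^3 \<Rightarrow> real" where
  "induced_metric X p u v = mink (D X p u) (D X p v)"

definition shape_operator ::
  "(real^3 \<Rightarrow> real^4) \<Rightarrow> (real^3 \<Rightarrow> real^4) \<Rightarrow> real^3 \<Rightarrow> real^3 \<Rightarrow> real^3" where
  "shape_operator X N p u = (THE z. D X p z = - D N p u)"

text \<open>The eigenvalues of the shape operator, listed with algebraic multiplicity in some order.\<close>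

definition principal_curvatures :: "(real^3 \<Rightarrow> real^4) \<Rightarrow> (real^3 \<Rightarrow> real^4) \<Rightarrow> real^3 \<Rightarrow> real^3" where
  "principal_curvatures X N p =
     (SOME \<kappa>. \<forall>x. det (x *\<^sub>R mat 1 - matrix (shape_operator X N p)) = (\<Prod>i\<in>UNIV. x - \<kappa>$i))"

definition curv_coeff :: "(real^3 \<Rightarrow> real^4) \<Rightarrow> (real^3 \<Rightarrow> real^4) \<Rightarrow> nat \<Rightarrow> real^3 \<Rightarrow> real" where
  "curv_coeff X N k p =
     (-1)^k * (\<Sum>A | A \<subseteq> (UNIV :: 3 set) \<and> card A = k. \<Prod>i\<in>A. principal_curvatures X N p $ i)"

definition mean_curv :: "(real^3 \<Rightarrow> real^4) \<Rightarrow> (real^3 \<Rightarrow> real^4) \<Rightarrow> nat \<Rightarrow> real^3 \<Rightarrow> real" where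
  "mean_curv X N k p = (- mink (N p) (N p))^k * curv_coeff X N k p / real (3 choose k)"

definition gradient :: "(real^3 \<Rightarrow> real^4) \<Rightarrow> (real^3 \<Rightarrow> real) \<Rightarrow> real^3 \<Rightarrow> real^3" where
  "gradient X f p = (THE z. \<forall>v. induced_metric X p z v = D f p v)"

text \<open>The Levi-Civita derivative \<open>\<nabla>\<^sub>u v\<close> of constant parameter fields is the tangential part of
  the second derivative of \<open>X\<close>.\<close>

definition levi_civita :: "(real^3 \<Rightarrow> real^4) \<Rightarrow> real^3 \<Rightarrow> real^3 \<Rightarrow> real^3 \<Rightarrow> real^3" where
  "levi_civita X p u v =
     (THE z. \<forall>x. induced_metric X p z x = mink (D (\<lambda>q. D X q v) p u) (D X p x))"

definition hessian_form ::
  "(real^3 \<Rightarrow> real^4) \<Rightarrow> (real^3 \<Rightarrow> real) \<Rightarrow> real^3 \<Rightarrow> real^3 \<Rightarrow> real^3 \<Rightarrow> real" where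
  "hessian_form X f p u v = D (\<lambda>q. D f q v) p u - D f p (levi_civita X p u v)"

definition hessian_operator ::
  "(real^3 \<Rightarrow> real^4) \<Rightarrow> (real^3 \<Rightarrow> real) \<Rightarrow> real^3 \<Rightarrow> real^3 \<Rightarrow> real^3" where
  "hessian_operator X f p u = (THE z. \<forall>v. induced_metric X p z v = hessian_form X f p u v)"

primrec newton ::
  "(real^3 \<Rightarrow> real^4) \<Rightarrow> (real^3 \<Rightarrow> real^4) \<Rightarrow> nat \<Rightarrow> real^3 \<Rightarrow> real^3 \<Rightarrow> real^3" where
  "newton X N 0 p u = u"
| "newton X N (Suc k) p u =
     curv_coeff X N (Suc k) p *\<^sub>R u + shape_operator X N p (newton X N k p u)"

text \<open>Linearised operators \<open>L\<^sub>k f = tr (P\<^sub>k \<circ> \<nabla>\<^sup>2 f)\<close> of Cheng and Yau, with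
  \<open>P\<^sub>0 = I\<close>, \<open>P\<^sub>k = a\<^sub>k I + S \<circ> P\<^sub>k\<^sub>-\<^sub>1\<close>.\<close>

definition cheng_yau ::
  "(real^3 \<Rightarrow> real^4) \<Rightarrow> (real^3 \<Rightarrow> real^4) \<Rightarrow> nat \<Rightarrow> (real^3 \<Rightarrow> real) \<Rightarrow> real^3 \<Rightarrow> real" where
  "cheng_yau X N k f p = trace (matrix (\<lambda>u. newton X N k p (hessian_operator X f p u)))"

definition cheng_yau_vec ::
  "(real^3 \<Rightarrow> real^4) \<Rightarrow> (real^3 \<Rightarrow> real^4) \<Rightarrow> nat \<Rightarrow> (real^3 \<Rightarrow> real^4) \<Rightarrow> real^3 \<Rightarrow> real^4" where
  "cheng_yau_vec X N k V p = (\<chi> i. cheng_yau X N k (\<lambda>q. V q $ i) p)"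

text \<open>The rest of this theory proves that on a tube the operator above satisfies
  \<open>L\<^sub>1 N = -\<epsilon> C\<^sub>1 (\<nabla>H\<^sub>2 + (3 H\<^sub>1 H\<^sub>2 - H\<^sub>3) N)\<close> with \<open>C\<^sub>1 = -3\<epsilon>\<close>; see
  \<open>cheng_yau_gauss_map\<close> at the end, where \<open>\<nabla>H\<^sub>2\<close> is
  the ambient vector \<open>dX\<close> of the pulled-back gradient.\<close>


lemma mink_simps:
  "mink (x + y) z = mink x z + mink y z" "mink x (y + z) = mink x y + mink x z"
  "mink (x - y) z = mink x z - mink y z" "mink x (y - z) = mink x y - mink x z"
  "mink (c *\<^sub>R x) y = c * mink x y" "mink x (c *\<^sub>R y) = c * mink x y"
  "mink (- x) y = - mink x y" "mink x (- y) = - mink x y"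
  "mink 0 x = 0" "mink x 0 = 0"
  by (simp_all add: mink_def algebra_simps)

lemma mink_commute: "mink x y = mink y x"
  by (simp add: mink_def algebra_simps)

lemma bounded_bilinear_mink: "bounded_bilinear mink"
proof -
  have "bilinear mink"
    unfolding bilinear_def by (auto intro!: linearI simp: mink_simps)
  then show ?thesis by (simp add: bilinear_conv_bounded_bilinear)
qed

lemma mink_nondegenerate:
  assumes "orthonormal_frame e1 e2 e3 e4"
    and "mink v e1 = 0" "mink v e2 = 0" "mink v e3 = 0" "mink v e4 = 0"
  shows "v = 0"
proof -
  define B where "B = {e1, e2, e3, e4}"
  note o = assms(1)[unfolded orthonormal_frame_def]
  have o': "mink e2 e1 = 0" "mink e3 e1 = 0" "mink e4 e1 = 0"
    "mink e3 e2 = 0" "mink e4 e2 = 0" "mink e4 e3 = 0"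
    using o by (simp_all add: mink_commute)
  have ne: "e1 \<noteq> e2" "e1 \<noteq> e3" "e1 \<noteq> e4" "e2 \<noteq> e3" "e2 \<noteq> e4" "e3 \<noteq> e4"
    using o by auto
  have card: "card B = 4" using ne by (simp add: B_def)
  have fin: "finite B" by (simp add: B_def)
  have "independent B"
  proof (rule independent_if_scalars_zero[OF fin])
    fix f x assume s: "(\<Sum>x\<in>B. f x *\<^sub>R x) = 0" and x: "x \<in> B"
    have s': "f e1 *\<^sub>R e1 + f e2 *\<^sub>R e2 + f e3 *\<^sub>R e3 + f e4 *\<^sub>R e4 = 0"
      using s ne by (simp add: B_def add.assoc)
    have m: "mink (f e1 *\<^sub>R e1 + f e2 *\<^sub>R e2 + f e3 *\<^sub>R e3 + f e4 *\<^sub>R e4) y = 0" for y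
      using s' by (simp add: mink_simps)
    show "f x = 0"
      using m[of e1] m[of e2] m[of e3] m[of e4] x o o' by (auto simp: B_def mink_simps)
  qed
  then have sp: "span B = UNIV"
    using card_eq_dim[of B UNIV] card fin by auto
  have z: "mink v y = 0" for y
  proof -
    have "y \<in> span B" using sp by simp
    then show ?thesis
      by (induction rule: span_induct_alt) (use assms in \<open>auto simp: mink_simps B_def\<close>)
  qed
  have "v $ i = 0" for i
    using z[of "axis i 1"] exhaust_4[of i] by (auto simp: mink_def axis_def)
  then show ?thesis by (simp add: vec_eq_iff)
qed

lemma has_derivative_nth1:
  assumes "(f has_vector_derivative f') (at (q$1))"
  shows "((\<lambda>q::real^3. f (q$1)) has_derivative (\<lambda>u. u$1 *\<^sub>R f')) (at q)"
proof -
  have 1: "((\<lambda>q::real^3. q$1) has_derivative (\<lambda>u. u$1)) (at q)"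
    by (rule bounded_linear_imp_has_derivative[OF bounded_linear_vec_nth])
  show ?thesis
    using has_derivative_compose[OF 1, of f "\<lambda>x. x *\<^sub>R f'"] assms
    by (simp add: has_vector_derivative_def)
qed

lemma has_derivative_vec_nth:
  "((\<lambda>q::real^3. q$i) has_derivative (\<lambda>u. u$i)) F"
  by (rule bounded_linear_imp_has_derivative[OF bounded_linear_vec_nth])

lemma D_eqI: "(f has_derivative f') (at p) \<Longrightarrow> D f p = f'"
  using frechet_derivative_at by metis

locale frenet_tube =
  fixes r :: real and I :: "real set" and U :: "(real^3) set"
    and \<beta> F1 F2 F3 F4 :: "real \<Rightarrow> real^4" and k1 k2 k3 :: "real \<Rightarrow> real"
  assumes r: "r > 0"
    and frenet: "timelike_frenet_curve I \<beta> F1 F2 F3 F4 k1 k2 k3"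
    and U: "open U"
    and proj: "(\<lambda>p. p$1) ` U = I"
    and imm: "immersion_on U (tube r \<beta> F2 F3 F4)"
begin

abbreviation "X \<equiv> tube r \<beta> F2 F3 F4"
abbreviation "N \<equiv> tube_normal F2 F3 F4"
abbreviation "n \<equiv> tube_dir F2 F3 F4"

definition dn :: "real^3 \<Rightarrow> real^3 \<Rightarrow> real^4" where
  "dn q u = u$1 *\<^sub>R ((cos (q$2) * cos (q$3)) *\<^sub>R (k1 (q$1) *\<^sub>R F1 (q$1) + k2 (q$1) *\<^sub>R F3 (q$1))
      + (sin (q$2) * cos (q$3)) *\<^sub>R (- k2 (q$1) *\<^sub>R F2 (q$1) + k3 (q$1) *\<^sub>R F4 (q$1))
      + sin (q$3) *\<^sub>R (- k3 (q$1) *\<^sub>R F3 (q$1)))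
    + u$2 *\<^sub>R (- (sin (q$2) * cos (q$3)) *\<^sub>R F2 (q$1) + (cos (q$2) * cos (q$3)) *\<^sub>R F3 (q$1))
    + u$3 *\<^sub>R (- (cos (q$2) * sin (q$3)) *\<^sub>R F2 (q$1) - (sin (q$2) * sin (q$3)) *\<^sub>R F3 (q$1)
              + cos (q$3) *\<^sub>R F4 (q$1))"

lemma dI: "q \<in> U \<Longrightarrow> q$1 \<in> I"
  using proj by blast

lemma n_deriv:
  assumes "q \<in> U" shows "(n has_derivative dn q) (at q)"
proof -
  note f = frenet[unfolded timelike_frenet_curve_def]
  have a: "((\<lambda>q::real^3. F2 (q$1)) has_derivative (\<lambda>u. u$1 *\<^sub>R (k1 (q$1) *\<^sub>R F1 (q$1) + k2 (q$1) *\<^sub>R F3 (q$1)))) (at q)"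
   "((\<lambda>q::real^3. F3 (q$1)) has_derivative (\<lambda>u. u$1 *\<^sub>R (- k2 (q$1) *\<^sub>R F2 (q$1) + k3 (q$1) *\<^sub>R F4 (q$1)))) (at q)"
   "((\<lambda>q::real^3. F4 (q$1)) has_derivative (\<lambda>u. u$1 *\<^sub>R (- k3 (q$1) *\<^sub>R F3 (q$1)))) (at q)"
    by (rule has_derivative_nth1; use f dI[OF assms] in blast)+
  show ?thesis
    unfolding tube_dir_def[abs_def]
    apply (rule derivative_eq_intros a has_derivative_vec_nth refl)+
    apply (simp add: fun_eq_iff dn_def algebra_simps)
    done
qed

lemma X_deriv:
  assumes "q \<in> U" shows "(X has_derivative (\<lambda>u. u$1 *\<^sub>R F1 (q$1) + r *\<^sub>R dn q u)) (at q)"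
proof -
  have a: "((\<lambda>q::real^3. \<beta> (q$1)) has_derivative (\<lambda>u. u$1 *\<^sub>R F1 (q$1))) (at q)"
    by (rule has_derivative_nth1; use frenet dI[OF assms] in \<open>simp add: timelike_frenet_curve_def\<close>)
  show ?thesis unfolding tube_def[abs_def]
    by (rule derivative_eq_intros a n_deriv[OF assms] refl)+ (simp add: fun_eq_iff)
qed

lemma N_deriv: "q \<in> U \<Longrightarrow> (N has_derivative (\<lambda>u. - dn q u)) (at q)"
  unfolding tube_normal_def[abs_def] by (rule has_derivative_minus[OF n_deriv])

lemma DX: "q \<in> U \<Longrightarrow> D X q u = u$1 *\<^sub>R F1 (q$1) + r *\<^sub>R dn q u"
  by (simp add: D_eqI[OF X_deriv])
lemma DN: "q \<in> U \<Longrightarrow> D N q u = - dn q u"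
  by (simp add: D_eqI[OF N_deriv])

definition a where "a q = k2 (q$1) - k3 (q$1) * cos (q$2) * sin (q$3) / cos (q$3)"
definition b where "b q = k3 (q$1) * sin (q$2)"
definition \<phi> where "\<phi> q = 1 + r * k1 (q$1) * cos (q$2) * cos (q$3)" for q :: "real^3"
definition nt where "nt q = - (sin (q$2) * cos (q$3)) *\<^sub>R F2 (q$1) + (cos (q$2) * cos (q$3)) *\<^sub>R F3 (q$1)" for q :: "real^3"
definition nw where "nw q = - (cos (q$2) * sin (q$3)) *\<^sub>R F2 (q$1) - (sin (q$2) * sin (q$3)) *\<^sub>R F3 (q$1)
              + cos (q$3) *\<^sub>R F4 (q$1)" for q :: "real^3"
definition e0 :: "real^3 \<Rightarrow> real^3" where "e0 q = vector [1, - a q, - b q]"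
definition \<kappa>3 where "\<kappa>3 q = k1 (q$1) * cos (q$2) * cos (q$3) / \<phi> q"

lemma inj0: assumes "q \<in> U" "D X q z = 0" shows "z = 0"
proof -
  have "inj (D X q)" using imm assms(1) by (auto simp: immersion_on_def)
  moreover have "D X q 0 = 0" using assms(1) by (simp add: DX dn_def)
  ultimately show ?thesis using assms(2) by (metis injD)
qed

lemma cw: assumes "q \<in> U" shows "cos (q$3) \<noteq> 0"
proof
  assume "cos (q$3) = 0"
  then have "D X q (vector [0,1,0]) = 0" by (simp add: DX[OF assms] dn_def)
  then have "vector [0,1,0] = (0::real^3)" using inj0[OF assms] by blast
  then show False by (metis vector_3(2) zero_index zero_neq_one)
qed

lemma dn_eq: assumes "q \<in> U"
  shows "dn q u = (u$1 * k1 (q$1) * cos (q$2) * cos (q$3)) *\<^sub>R F1 (q$1)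
    + (u$2 + a q * u$1) *\<^sub>R nt q + (u$3 + b q * u$1) *\<^sub>R nw q"
proof -
  have c: "cos (q$3) \<noteq> 0" using cw[OF assms] .
  have *: "sin (q$2) * sin (q$2) = 1 - cos (q$2) * cos (q$2)"
    using sin_cos_squared_add3[of "q$2"] by (simp add: algebra_simps)
  have aa: "a q * cos (q$3) = k2 (q$1) * cos (q$3) - k3 (q$1) * cos (q$2) * sin (q$3)"
    using c by (simp add: a_def field_simps)
  have 2: "u$1 * (- (k2 (q$1)) * sin (q$2) * cos (q$3)) - u$2 * sin (q$2) * cos (q$3) - u$3 * cos (q$2) * sin (q$3)
    = - (u$2 + a q * u$1) * (sin (q$2) * cos (q$3)) - (u$3 + b q * u$1) * (cos (q$2) * sin (q$3))"
  proof -
    have "a q * u$1 * (sin (q$2) * cos (q$3)) = (k2 (q$1) * cos (q$3) - k3 (q$1) * cos (q$2) * sin (q$3)) * (u$1 * sin (q$2))"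
      using aa by (metis (no_types, opaque_lifting) mult.assoc mult.commute)
    then show ?thesis by (simp add: b_def algebra_simps)
  qed
  have 3: "u$1 * (k2 (q$1) * cos (q$2) * cos (q$3) - k3 (q$1) * sin (q$3)) + u$2 * cos (q$2) * cos (q$3) - u$3 * sin (q$2) * sin (q$3)
    = (u$2 + a q * u$1) * (cos (q$2) * cos (q$3)) - (u$3 + b q * u$1) * (sin (q$2) * sin (q$3))"
  proof -
    have "a q * u$1 * (cos (q$2) * cos (q$3)) = (k2 (q$1) * cos (q$3) - k3 (q$1) * cos (q$2) * sin (q$3)) * (u$1 * cos (q$2))"
      using aa by (metis (no_types, opaque_lifting) mult.assoc mult.commute)
    moreover have "b q * u$1 * (sin (q$2) * sin (q$3)) = k3 (q$1) * u$1 * sin (q$3) * (1 - cos (q$2) * cos (q$2))"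
      by (simp add: b_def *[symmetric] algebra_simps)
    ultimately show ?thesis by (simp add: algebra_simps)
  qed
  have "dn q u = (u$1 * k1 (q$1) * cos (q$2) * cos (q$3)) *\<^sub>R F1 (q$1)
    + (u$1 * (- (k2 (q$1)) * sin (q$2) * cos (q$3)) - u$2 * sin (q$2) * cos (q$3) - u$3 * cos (q$2) * sin (q$3)) *\<^sub>R F2 (q$1)
    + (u$1 * (k2 (q$1) * cos (q$2) * cos (q$3) - k3 (q$1) * sin (q$3)) + u$2 * cos (q$2) * cos (q$3) - u$3 * sin (q$2) * sin (q$3)) *\<^sub>R F3 (q$1)
    + (u$1 * k3 (q$1) * sin (q$2) * cos (q$3) + u$3 * cos (q$3)) *\<^sub>R F4 (q$1)"
    by (simp add: dn_def algebra_simps)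
  also have "\<dots> = (u$1 * k1 (q$1) * cos (q$2) * cos (q$3)) *\<^sub>R F1 (q$1)
    + (u$2 + a q * u$1) *\<^sub>R nt q + (u$3 + b q * u$1) *\<^sub>R nw q"
    unfolding 2 3 by (simp add: nt_def nw_def b_def algebra_simps)
  finally show ?thesis .
qed

lemma DX_eq: assumes "q \<in> U"
  shows "D X q u = (\<phi> q * u$1) *\<^sub>R F1 (q$1)
    + (r * (u$2 + a q * u$1)) *\<^sub>R nt q + (r * (u$3 + b q * u$1)) *\<^sub>R nw q"
  by (simp add: DX[OF assms] dn_eq[OF assms] \<phi>_def algebra_simps)

lemma e0_nth [simp]: "e0 q $ 1 = 1" "e0 q $ 2 = - a q" "e0 q $ 3 = - b q"
  by (simp_all add: e0_def)

lemma ph: assumes "q \<in> U" shows "\<phi> q \<noteq> 0"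
proof
  assume "\<phi> q = 0"
  then have "D X q (e0 q) = 0" by (simp add: DX_eq[OF assms])
  then have "e0 q = 0" using inj0[OF assms] by blast
  then show False by (metis e0_nth(1) zero_index zero_neq_one)
qed

lemma frame: "q \<in> U \<Longrightarrow> orthonormal_frame (F1 (q$1)) (F2 (q$1)) (F3 (q$1)) (F4 (q$1))"
  using frenet dI by (auto simp: timelike_frenet_curve_def)

lemma fr: assumes "q \<in> U"
  shows "mink (F1 (q$1)) (F1 (q$1)) = -1" "mink (F2 (q$1)) (F2 (q$1)) = 1"
   "mink (F3 (q$1)) (F3 (q$1)) = 1" "mink (F4 (q$1)) (F4 (q$1)) = 1"
   "mink (F1 (q$1)) (F2 (q$1)) = 0" "mink (F1 (q$1)) (F3 (q$1)) = 0" "mink (F1 (q$1)) (F4 (q$1)) = 0"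
   "mink (F2 (q$1)) (F3 (q$1)) = 0" "mink (F2 (q$1)) (F4 (q$1)) = 0" "mink (F3 (q$1)) (F4 (q$1)) = 0"
   "mink (F2 (q$1)) (F1 (q$1)) = 0" "mink (F3 (q$1)) (F1 (q$1)) = 0" "mink (F4 (q$1)) (F1 (q$1)) = 0"
   "mink (F3 (q$1)) (F2 (q$1)) = 0" "mink (F4 (q$1)) (F2 (q$1)) = 0" "mink (F4 (q$1)) (F3 (q$1)) = 0"
  using frame[OF assms] by (auto simp: orthonormal_frame_def mink_commute)

lemma trig: "sin x * (sin x * y) = y - cos x * (cos x * y)" "sin x * sin x = 1 - cos x * cos x" for x y :: real
proof -
  show *: "sin x * sin x = 1 - cos x * cos x"
    using sin_cos_squared_add3[of x] by (simp add: algebra_simps)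
  have "sin x * (sin x * y) = (1 - cos x * cos x) * y" using * by (metis mult.assoc)
  then show "sin x * (sin x * y) = y - cos x * (cos x * y)" by (simp add: algebra_simps)
qed

lemma ip: assumes "q \<in> U"
  shows "mink (F1 (q$1)) (nt q) = 0" "mink (F1 (q$1)) (nw q) = 0" "mink (F1 (q$1)) (n q) = 0"
    "mink (nt q) (F1 (q$1)) = 0" "mink (nw q) (F1 (q$1)) = 0" "mink (n q) (F1 (q$1)) = 0"
    "mink (nt q) (nt q) = (cos (q$3))^2" "mink (nw q) (nw q) = 1" "mink (n q) (n q) = 1"
    "mink (nt q) (nw q) = 0" "mink (nw q) (nt q) = 0" "mink (n q) (nt q) = 0"
    "mink (nt q) (n q) = 0" "mink (n q) (nw q) = 0" "mink (nw q) (n q) = 0"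
  by (simp_all add: nt_def nw_def tube_dir_def mink_simps fr[OF assms] algebra_simps power2_eq_square trig)

lemma g_eq: assumes "q \<in> U"
  shows "induced_metric X q u v = - ((\<phi> q)^2) * u$1 * v$1 + (r * cos (q$3))^2 * (u$2 + a q * u$1) * (v$2 + a q * v$1)
     + r^2 * (u$3 + b q * u$1) * (v$3 + b q * v$1)"
  by (simp add: induced_metric_def DX_eq[OF assms] mink_simps ip[OF assms] fr[OF assms] power2_eq_square algebra_simps)

definition sharp :: "real^3 \<Rightarrow> (real^3 \<Rightarrow> real) \<Rightarrow> real^3" where
  "sharp q h = (- h (e0 q) / (\<phi> q)^2) *\<^sub>R e0 q + (h (axis 2 1) / (r * cos (q$3))^2) *\<^sub>R axis 2 1
     + (h (axis 3 1) / r^2) *\<^sub>R axis 3 1"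

lemma expand: "v = (v$1) *\<^sub>R e0 q + (v$2 + a q * v$1) *\<^sub>R axis 2 1 + (v$3 + b q * v$1) *\<^sub>R axis 3 1"
  by (simp add: vec_eq_iff forall_3 axis_def)

lemma g_sharp: assumes "q \<in> U" "linear h"
  shows "induced_metric X q (sharp q h) v = h v"
proof -
  have "h v = v$1 * h (e0 q) + (v$2 + a q * v$1) * h (axis 2 1) + (v$3 + b q * v$1) * h (axis 3 1)"
    by (subst expand[of v q]) (simp add: linear_add[OF assms(2)] linear_scale[OF assms(2)])
  then show ?thesis
    using ph[OF assms(1)] cw[OF assms(1)] r
    by (simp add: g_eq[OF assms(1)] sharp_def axis_def)
qed

lemma g_unique: assumes "q \<in> U" "\<And>v. induced_metric X q z v = induced_metric X q z' v" shows "z = z'"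
proof -
  have 1: "z$1 = z'$1" using assms(2)[of "e0 q"] ph[OF assms(1)] by (simp add: g_eq[OF assms(1)])
  have 2: "z$2 = z'$2" using assms(2)[of "axis 2 1"] 1 cw[OF assms(1)] r by (simp add: g_eq[OF assms(1)] axis_def)
  have 3: "z$3 = z'$3" using assms(2)[of "axis 3 1"] 1 cw[OF assms(1)] r by (simp add: g_eq[OF assms(1)] axis_def)
  show ?thesis using 1 2 3 by (simp add: vec_eq_iff forall_3)
qed

lemma the_sharp: assumes "q \<in> U" "linear h"
  shows "(THE z. \<forall>v. induced_metric X q z v = h v) = sharp q h"
  by (rule the_equality) (use g_sharp[OF assms] g_unique[OF assms(1)] in auto)

lemma shape: assumes "q \<in> U"
  shows "shape_operator X N q u = (1/r) *\<^sub>R u + (u$1 * (\<kappa>3 q - 1/r)) *\<^sub>R e0 q"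
  unfolding shape_operator_def
proof (rule the_equality)
  let ?z = "(1/r) *\<^sub>R u + (u$1 * (\<kappa>3 q - 1/r)) *\<^sub>R e0 q"
  have "\<phi> q * (u$1 / r + u$1 * (\<kappa>3 q - 1/r)) = u$1 * k1 (q$1) * cos (q$2) * cos (q$3)"
    using ph[OF assms] r by (simp add: \<kappa>3_def algebra_simps)
  then show z: "D X q ?z = - D N q u"
    using r by (simp add: DX_eq[OF assms] DN[OF assms] dn_eq[OF assms] algebra_simps)
  fix z assume "D X q z = - D N q u"
  then show "z = ?z" using z imm assms by (metis immersion_on_def injD)
qed

lemma charpoly: assumes "q \<in> U"
  shows "det (x *\<^sub>R mat 1 - matrix (shape_operator X N q)) = (x - 1/r) * (x - 1/r) * (x - \<kappa>3 q)"
proof -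
  define \<rho> where "\<rho> = 1/r"
  show ?thesis
    unfolding \<rho>_def[symmetric]
    by (simp add: det_3 matrix_def shape[OF assms, folded \<rho>_def] mat_def axis_def algebra_simps)
qed

lemma prod3: "(\<Prod>i\<in>(UNIV::3 set). f i) = f 1 * f 2 * (f 3 :: real)"
  unfolding UNIV_3 by (simp add: mult.assoc)

lemma quad0:
  assumes "\<And>x::real. x * x * a1 - x * a2 + a3 = 0"
  shows "a1 = 0" "a2 = 0" "a3 = 0"
  using assms[of 0] assms[of 1] assms[of "-1"] by auto

lemma pc: assumes "q \<in> U" defines "\<kappa> \<equiv> principal_curvatures X N q"
  shows "\<kappa>$1 + \<kappa>$2 + \<kappa>$3 = 2/r + \<kappa>3 q"
    "\<kappa>$1*\<kappa>$2 + \<kappa>$1*\<kappa>$3 + \<kappa>$2*\<kappa>$3 = 1/r^2 + 2*\<kappa>3 q/r"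
    "\<kappa>$1 * \<kappa>$2 * \<kappa>$3 = \<kappa>3 q / r^2"
proof -
  have "\<forall>x. det (x *\<^sub>R mat 1 - matrix (shape_operator X N q)) = (\<Prod>i\<in>UNIV. x - (vector [1/r, 1/r, \<kappa>3 q] :: real^3)$i)"
    unfolding charpoly[OF assms(1)] prod3 by simp
  then have "\<forall>x. det (x *\<^sub>R mat 1 - matrix (shape_operator X N q)) = (\<Prod>i\<in>UNIV. x - \<kappa>$i)"
    unfolding \<kappa>_def principal_curvatures_def by (rule someI)
  then have e: "(x - 1/r) * (x - 1/r) * (x - \<kappa>3 q) = (x - \<kappa>$1) * (x - \<kappa>$2) * (x - \<kappa>$3)" for x
    unfolding charpoly[OF assms(1)] prod3 by blast
  define \<rho> where "\<rho> = 1/r"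
  have e': "(x - \<rho>) * (x - \<rho>) * (x - \<kappa>3 q) = (x - \<kappa>$1) * (x - \<kappa>$2) * (x - \<kappa>$3)" for x
    using e by (simp add: \<rho>_def)
  have E: "x * x * ((\<kappa>$1 + \<kappa>$2 + \<kappa>$3) - (2*\<rho> + \<kappa>3 q)) - x * ((\<kappa>$1*\<kappa>$2 + \<kappa>$1*\<kappa>$3 + \<kappa>$2*\<kappa>$3) - (\<rho>*\<rho> + 2*\<kappa>3 q*\<rho>))
     + (\<kappa>$1 * \<kappa>$2 * \<kappa>$3 - \<kappa>3 q * (\<rho>*\<rho>)) = 0" for x
    using e'[of x] by algebra
  have e1: "\<kappa>$1 + \<kappa>$2 + \<kappa>$3 = 2*\<rho> + \<kappa>3 q"
    and e2: "\<kappa>$1*\<kappa>$2 + \<kappa>$1*\<kappa>$3 + \<kappa>$2*\<kappa>$3 = \<rho>*\<rho> + 2*\<kappa>3 q*\<rho>"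
    and e3: "\<kappa>$1 * \<kappa>$2 * \<kappa>$3 = \<kappa>3 q * (\<rho>*\<rho>)"
    using quad0[OF E] by linarith+
  show "\<kappa>$1 + \<kappa>$2 + \<kappa>$3 = 2/r + \<kappa>3 q" unfolding e1 \<rho>_def by simp
  show "\<kappa>$1*\<kappa>$2 + \<kappa>$1*\<kappa>$3 + \<kappa>$2*\<kappa>$3 = 1/r^2 + 2*\<kappa>3 q/r"
    unfolding e2 \<rho>_def by (simp add: power2_eq_square)
  show "\<kappa>$1 * \<kappa>$2 * \<kappa>$3 = \<kappa>3 q / r^2" unfolding e3 \<rho>_def by (simp add: power2_eq_square)
qed

lemma esym3:
  fixes x :: "real^3"
  shows "(\<Sum>A | A \<subseteq> (UNIV::3 set) \<and> card A = 1. \<Prod>i\<in>A. x$i) = x$1 + x$2 + x$3"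
    "(\<Sum>A | A \<subseteq> (UNIV::3 set) \<and> card A = 2. \<Prod>i\<in>A. x$i) = x$1*x$2 + x$1*x$3 + x$2*x$3"
    "(\<Sum>A | A \<subseteq> (UNIV::3 set) \<and> card A = 3. \<Prod>i\<in>A. x$i) = x$1 * x$2 * x$3"
proof -
  have P: "Pow (UNIV::3 set) = {{}, {1}, {2}, {3}, {1,2}, {1,3}, {2,3}, {1,2,3}}"
    unfolding UNIV_3 by (simp add: Pow_insert) auto
  have S: "{A. A \<subseteq> (UNIV::3 set) \<and> card A = k} = {A \<in> {{}, {1}, {2}, {3}, {1,2}, {1,3}, {2,3}, {1,2,3}}. card A = k}" for k
    unfolding P[symmetric] by auto
  have d: "(1::3) \<noteq> 2" "(1::3) \<noteq> 3" "(2::3) \<noteq> 3" by simp_all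
  have S1: "{A. A \<subseteq> (UNIV::3 set) \<and> card A = 1} = {{1},{2},{3}}" unfolding S using d by auto
  have S2: "{A. A \<subseteq> (UNIV::3 set) \<and> card A = 2} = {{1,2},{1,3},{2,3}}" unfolding S using d by auto
  have S3: "{A. A \<subseteq> (UNIV::3 set) \<and> card A = 3} = {{1,2,3}}" unfolding S using d by auto
  have d2: "{1::3,2} \<noteq> {1,3}" "{1::3,2} \<noteq> {2,3}" "{1::3,3} \<noteq> {2,3}" by (auto simp: doubleton_eq_iff)
  show "(\<Sum>A | A \<subseteq> (UNIV::3 set) \<and> card A = 1. \<Prod>i\<in>A. x$i) = x$1 + x$2 + x$3" unfolding S1 by simp
  show "(\<Sum>A | A \<subseteq> (UNIV::3 set) \<and> card A = 2. \<Prod>i\<in>A. x$i) = x$1*x$2 + x$1*x$3 + x$2*x$3" unfolding S2 using d2 by simp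
  show "(\<Sum>A | A \<subseteq> (UNIV::3 set) \<and> card A = 3. \<Prod>i\<in>A. x$i) = x$1 * x$2 * x$3" unfolding S3 by simp
qed

lemma coeffs: assumes "q \<in> U"
  shows "curv_coeff X N 1 q = - (2/r + \<kappa>3 q)" "curv_coeff X N 2 q = 1/r^2 + 2*\<kappa>3 q/r"
    "curv_coeff X N 3 q = - (\<kappa>3 q / r^2)"
  unfolding curv_coeff_def esym3 pc[OF assms] by simp_all

lemma NN: "q \<in> U \<Longrightarrow> mink (N q) (N q) = 1"
  by (simp add: tube_normal_def mink_simps ip)

lemma means: assumes "q \<in> U"
  shows "mean_curv X N 1 q = (2/r + \<kappa>3 q) / 3" "mean_curv X N 2 q = (1/r^2 + 2*\<kappa>3 q/r) / 3"
    "mean_curv X N 3 q = \<kappa>3 q / r^2"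
proof -
  have c: "(3 choose 1) = (3::nat)" "(3 choose 2) = (3::nat)" "(3 choose 3) = (1::nat)"
    by (simp_all add: choose_two)
  show "mean_curv X N 1 q = (2/r + \<kappa>3 q) / 3" "mean_curv X N 2 q = (1/r^2 + 2*\<kappa>3 q/r) / 3"
    "mean_curv X N 3 q = \<kappa>3 q / r^2"
    unfolding mean_curv_def coeffs[OF assms] NN[OF assms] c by simp_all
qed

lemma k1_deriv: assumes "p \<in> U"
  obtains k' where "((\<lambda>q::real^3. k1 (q$1)) has_derivative (\<lambda>u. u$1 * k')) (at p)"
proof -
  have "smooth_on I k1" using frenet by (simp add: timelike_frenet_curve_def)
  then have "k1 differentiable (at (p$1))"
    using dI[OF assms] unfolding smooth_on_def by (metis funpow_0)
  then obtain k' where "(k1 has_vector_derivative k') (at (p$1))"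
    by (metis vector_derivative_works)
  from has_derivative_nth1[OF this] show ?thesis using that by simp
qed

lemma k_diff: assumes "p \<in> U"
  shows "(\<lambda>q::real^3. k1 (q$1)) differentiable (at p)" "(\<lambda>q::real^3. k2 (q$1)) differentiable (at p)"
    "(\<lambda>q::real^3. k3 (q$1)) differentiable (at p)"
proof -
  have *: "(\<lambda>q::real^3. k (q$1)) differentiable (at p)" if "smooth_on I k" for k :: "real \<Rightarrow> real"
  proof -
    have "k differentiable (at (p$1))"
      using that dI[OF assms] unfolding smooth_on_def by (metis funpow_0)
    then obtain k' where "(k has_vector_derivative k') (at (p$1))"
      by (metis vector_derivative_works)
    from has_derivative_nth1[OF this] show ?thesis by (auto simp: differentiable_def)
  qed
  show "(\<lambda>q::real^3. k1 (q$1)) differentiable (at p)" "(\<lambda>q::real^3. k2 (q$1)) differentiable (at p)"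
    "(\<lambda>q::real^3. k3 (q$1)) differentiable (at p)"
    by (rule *; use frenet in \<open>simp add: timelike_frenet_curve_def\<close>)+
qed

lemma F_diff: assumes "p \<in> U"
  shows "((\<lambda>q::real^3. F1 (q$1)) has_derivative (\<lambda>u. u$1 *\<^sub>R (k1 (p$1) *\<^sub>R F2 (p$1)))) (at p)"
   "(\<lambda>q::real^3. F2 (q$1)) differentiable (at p)" "(\<lambda>q::real^3. F3 (q$1)) differentiable (at p)"
   "(\<lambda>q::real^3. F4 (q$1)) differentiable (at p)"
proof -
  note f = frenet[unfolded timelike_frenet_curve_def]
  show "((\<lambda>q::real^3. F1 (q$1)) has_derivative (\<lambda>u. u$1 *\<^sub>R (k1 (p$1) *\<^sub>R F2 (p$1)))) (at p)"
    by (rule has_derivative_nth1; use f dI[OF assms] in blast)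
  show "(\<lambda>q::real^3. F2 (q$1)) differentiable (at p)" "(\<lambda>q::real^3. F3 (q$1)) differentiable (at p)"
   "(\<lambda>q::real^3. F4 (q$1)) differentiable (at p)"
    unfolding differentiable_def
    using f dI[OF assms] has_derivative_nth1 by blast+
qed

lemma trig_diff:
  "(\<lambda>q::real^3. cos (q$i)) differentiable (at p)" "(\<lambda>q::real^3. sin (q$i)) differentiable (at p)"
  using has_derivative_cos[OF has_derivative_vec_nth[of i "at p"]] has_derivative_sin[OF has_derivative_vec_nth[of i "at p"]]
  by (auto simp: differentiable_def)

lemma DX_diff: assumes "p \<in> U"
  shows "((\<lambda>q. D X q v) has_derivative D (\<lambda>q. D X q v) p) (at p)"
proof -
  have "(\<lambda>q. v$1 *\<^sub>R F1 (q$1) + r *\<^sub>R dn q v) differentiable (at p)"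
    unfolding dn_def
    by (intro differentiable_add differentiable_diff differentiable_scaleR differentiable_minus differentiable_mult
      differentiable_const k_diff[OF assms] F_diff(2-4)[OF assms] differentiableI[OF F_diff(1)[OF assms]] trig_diff)
  then obtain G where "((\<lambda>q. v$1 *\<^sub>R F1 (q$1) + r *\<^sub>R dn q v) has_derivative G) (at p)"
    by (auto simp: differentiable_def)
  then have "((\<lambda>q. D X q v) has_derivative G) (at p)"
    by (rule has_derivative_transform_within_open[OF _ U assms]) (simp add: DX)
  then show ?thesis by (simp add: D_eqI)
qed

lemma phi_diff: assumes "p \<in> U" shows "(\<phi> has_derivative D \<phi> p) (at p)"
proof -
  have "\<phi> differentiable (at p)"
    unfolding \<phi>_def[abs_def]
    by (intro differentiable_add differentiable_mult differentiable_const k_diff[OF assms] trig_diff)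
  then show ?thesis by (simp add: frechet_derivative_works)
qed

lemma phi_tw: assumes "p \<in> U"
  shows "D \<phi> p (axis 2 1) = - r * k1 (p$1) * sin (p$2) * cos (p$3)"
    "D \<phi> p (axis 3 1) = - r * k1 (p$1) * cos (p$2) * sin (p$3)"
proof -
  obtain k' where k': "((\<lambda>q::real^3. k1 (q$1)) has_derivative (\<lambda>u. u$1 * k')) (at p)"
    using k1_deriv[OF assms] .
  have "(\<phi> has_derivative (\<lambda>u. r * (u$1 * k') * cos (p$2) * cos (p$3)
     - r * k1 (p$1) * sin (p$2) * cos (p$3) * u$2 - r * k1 (p$1) * cos (p$2) * sin (p$3) * u$3)) (at p)"
    unfolding \<phi>_def[abs_def]
    by (rule derivative_eq_intros k' has_derivative_vec_nth refl)+ (simp add: fun_eq_iff algebra_simps)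
  from D_eqI[OF this] show "D \<phi> p (axis 2 1) = - r * k1 (p$1) * sin (p$2) * cos (p$3)"
    "D \<phi> p (axis 3 1) = - r * k1 (p$1) * cos (p$2) * sin (p$3)"
    by (simp_all add: axis_def)
qed

lemma W1: assumes "p \<in> U"
  shows "mink (D (\<lambda>q. D X q v) p u) (F1 (p$1)) = - v$1 * D \<phi> p u - u$1 * k1 (p$1) * mink (D X p v) (F2 (p$1))"
proof -
  have 1: "((\<lambda>q. mink (D X q v) (F1 (q$1))) has_derivative
     (\<lambda>u. mink (D X p v) (u$1 *\<^sub>R (k1 (p$1) *\<^sub>R F2 (p$1))) + mink (D (\<lambda>q. D X q v) p u) (F1 (p$1)))) (at p)"
    by (rule bounded_bilinear.FDERIV[OF bounded_bilinear_mink DX_diff[OF assms] F_diff(1)[OF assms]])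
  have "((\<lambda>q. - v$1 * \<phi> q) has_derivative (\<lambda>u. - v$1 * D \<phi> p u)) (at p)"
    by (rule derivative_eq_intros phi_diff[OF assms] refl)+ simp
  then have 2: "((\<lambda>q. mink (D X q v) (F1 (q$1))) has_derivative (\<lambda>u. - v$1 * D \<phi> p u)) (at p)"
    by (rule has_derivative_transform_within_open[OF _ U assms]) (simp add: DX_eq mink_simps ip fr)
  from fun_cong[OF has_derivative_unique[OF 1 2], of u] show ?thesis by (simp add: mink_simps)
qed

lemma Wn: assumes "p \<in> U"
  shows "mink (D (\<lambda>q. D X q v) p u) (n p) = - mink (D X p v) (dn p u)"
proof -
  have 1: "((\<lambda>q. mink (D X q v) (n q)) has_derivative
     (\<lambda>u. mink (D X p v) (dn p u) + mink (D (\<lambda>q. D X q v) p u) (n p))) (at p)"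
    by (rule bounded_bilinear.FDERIV[OF bounded_bilinear_mink DX_diff[OF assms] n_deriv[OF assms]])
  have "((\<lambda>q. 0) has_derivative (\<lambda>u. 0)) (at p)" by simp
  then have 2: "((\<lambda>q. mink (D X q v) (n q)) has_derivative (\<lambda>u. 0)) (at p)"
    by (rule has_derivative_transform_within_open[OF _ U assms]) (simp add: DX_eq mink_simps ip fr)
  from fun_cong[OF has_derivative_unique[OF 1 2], of u] show ?thesis by simp
qed

lemma F_from_n:
  "F2 (q$1) = (cos (q$2) * cos (q$3)) *\<^sub>R n q - (sin (q$2) / cos (q$3)) *\<^sub>R nt q - (cos (q$2) * sin (q$3)) *\<^sub>R nw q"
  "F3 (q$1) = (sin (q$2) * cos (q$3)) *\<^sub>R n q + (cos (q$2) / cos (q$3)) *\<^sub>R nt q - (sin (q$2) * sin (q$3)) *\<^sub>R nw q"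
  "F4 (q$1) = sin (q$3) *\<^sub>R n q + cos (q$3) *\<^sub>R nw q" if "q \<in> U"
proof -
  have c: "cos (q$3) \<noteq> 0" using cw[OF that] .
  have *: "sin x * sin x = 1 - cos x * cos x" for x :: real
    using sin_cos_squared_add3[of x] by (simp add: algebra_simps)
  have 1: "(sin (q$2) / cos (q$3)) *\<^sub>R nt q = - (sin (q$2) * sin (q$2)) *\<^sub>R F2 (q$1) + (sin (q$2) * cos (q$2)) *\<^sub>R F3 (q$1)"
    using c by (simp add: nt_def algebra_simps)
  have 2: "(cos (q$2) / cos (q$3)) *\<^sub>R nt q = - (sin (q$2) * cos (q$2)) *\<^sub>R F2 (q$1) + (cos (q$2) * cos (q$2)) *\<^sub>R F3 (q$1)"
    using c by (simp add: nt_def algebra_simps)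
  show "F2 (q$1) = (cos (q$2) * cos (q$3)) *\<^sub>R n q - (sin (q$2) / cos (q$3)) *\<^sub>R nt q - (cos (q$2) * sin (q$3)) *\<^sub>R nw q"
    unfolding 1 by (simp add: nw_def tube_dir_def algebra_simps trig)
  show "F3 (q$1) = (sin (q$2) * cos (q$3)) *\<^sub>R n q + (cos (q$2) / cos (q$3)) *\<^sub>R nt q - (sin (q$2) * sin (q$3)) *\<^sub>R nw q"
    unfolding 2 by (simp add: nw_def tube_dir_def algebra_simps trig)
  show "F4 (q$1) = sin (q$3) *\<^sub>R n q + cos (q$3) *\<^sub>R nw q"
    by (simp add: nw_def tube_dir_def algebra_simps trig)
qed

lemma normal_part: assumes p: "p \<in> U" and t: "\<And>x. mink V (D X p x) = 0"
  shows "V = mink V (n p) *\<^sub>R n p"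
proof -
  let ?W = "V - mink V (n p) *\<^sub>R n p"
  have V: "mink V (F1 (p$1)) = 0" "mink V (nt p) = 0" "mink V (nw p) = 0"
    using t[of "e0 p"] t[of "axis 2 1"] t[of "axis 3 1"] ph[OF p] r
    by (simp_all add: DX_eq[OF p] mink_simps axis_def)
  have W: "mink ?W (F1 (p$1)) = 0" "mink ?W (nt p) = 0" "mink ?W (nw p) = 0" "mink ?W (n p) = 0"
    using V by (simp_all add: mink_simps ip[OF p])
  have "mink ?W (F2 (p$1)) = 0" "mink ?W (F3 (p$1)) = 0" "mink ?W (F4 (p$1)) = 0"
    by (subst F_from_n[OF p], simp only: mink_simps(2,4,6) W mult_zero_right diff_0_right add_0)+
  then have "?W = 0" using mink_nondegenerate[OF frame[OF p]] W(1) by blast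
  then show ?thesis by simp
qed

lemma linear_DX: "p \<in> U \<Longrightarrow> linear (D X p)"
  using has_derivative_linear[OF X_deriv] D_eqI[OF X_deriv] by simp

lemma LC: assumes p: "p \<in> U"
  shows "induced_metric X p (levi_civita X p u v) x = mink (D (\<lambda>q. D X q v) p u) (D X p x)"
proof -
  have l: "linear (\<lambda>x. mink (D (\<lambda>q. D X q v) p u) (D X p x))"
    by (rule linearI) (simp_all add: linear_add[OF linear_DX[OF p]] linear_scale[OF linear_DX[OF p]] mink_simps)
  show ?thesis
    unfolding levi_civita_def the_sharp[OF p l] by (rule g_sharp[OF p l])
qed

lemma LC1: assumes p: "p \<in> U"
  shows "levi_civita X p u v $ 1 = (v$1 * D \<phi> p u + u$1 * k1 (p$1) * mink (D X p v) (F2 (p$1))) / \<phi> p"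
proof -
  have e: "D X p (e0 p) = \<phi> p *\<^sub>R F1 (p$1)" by (simp add: DX_eq[OF p])
  let ?L = "levi_civita X p u v $ 1"
  have "induced_metric X p (levi_civita X p u v) (e0 p) = - ((\<phi> p)^2) * ?L"
    by (simp add: g_eq[OF p])
  then have "- ((\<phi> p)^2) * ?L = \<phi> p * (- v$1 * D \<phi> p u - u$1 * k1 (p$1) * mink (D X p v) (F2 (p$1)))"
    using LC[OF p, of u v "e0 p"] unfolding e mink_simps W1[OF p] by (simp only:)
  then have "\<phi> p * (\<phi> p * ?L) = \<phi> p * (v$1 * D \<phi> p u + u$1 * k1 (p$1) * mink (D X p v) (F2 (p$1)))"
    by (simp only: power2_eq_square) algebra
  then have "\<phi> p * ?L = v$1 * D \<phi> p u + u$1 * k1 (p$1) * mink (D X p v) (F2 (p$1))"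
    using ph[OF p] by simp
  then show ?thesis using ph[OF p] by (metis nonzero_mult_div_cancel_left)
qed

lemma LCn: assumes p: "p \<in> U"
  shows "D (\<lambda>q. D X q v) p u = D X p (levi_civita X p u v) - mink (D X p v) (dn p u) *\<^sub>R n p"
proof -
  let ?V = "D (\<lambda>q. D X q v) p u - D X p (levi_civita X p u v)"
  have "mink ?V (D X p x) = 0" for x
    using LC[OF p, of u v x] by (simp add: mink_simps induced_metric_def)
  from normal_part[OF p this] have "?V = mink ?V (n p) *\<^sub>R n p" .
  also have "mink ?V (n p) = - mink (D X p v) (dn p u)"
    unfolding mink_simps Wn[OF p] by (simp add: DX_eq[OF p] mink_simps ip[OF p])
  finally show ?thesis by (simp add: algebra_simps)
qed

definition HF :: "real^3 \<Rightarrow> real^3 \<Rightarrow> real^3 \<Rightarrow> real^4" where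
  "HF p u v = (1/r) *\<^sub>R ((u$1 * v$1 * k1 (p$1)) *\<^sub>R F2 (p$1)
     - ((v$1 * D \<phi> p u + u$1 * k1 (p$1) * mink (D X p v) (F2 (p$1))) / \<phi> p) *\<^sub>R F1 (p$1)
     + mink (D X p v) (dn p u) *\<^sub>R n p)"

lemma has_derivative_comp_nth:
  "(f has_derivative f') F \<Longrightarrow> ((\<lambda>q. f q $ i) has_derivative (\<lambda>u. f' u $ i)) F" for f :: "real^3 \<Rightarrow> real^4"
  by (rule bounded_linear.has_derivative[OF bounded_linear_vec_nth])

lemma hess: assumes p: "p \<in> U"
  shows "hessian_form X (\<lambda>q. N q $ i) p u v = HF p u v $ i"
proof -
  have D1: "D (\<lambda>q. N q $ i) q v = ((1/r) *\<^sub>R (v$1 *\<^sub>R F1 (q$1) - D X q v)) $ i" if "q \<in> U" for q v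
    using D_eqI[OF has_derivative_comp_nth[OF N_deriv[OF that]], of i] r by (simp add: DX[OF that])
  have "((\<lambda>q. (1/r) *\<^sub>R (v$1 *\<^sub>R F1 (q$1) - D X q v)) has_derivative
     (\<lambda>u. (1/r) *\<^sub>R (v$1 *\<^sub>R (u$1 *\<^sub>R (k1 (p$1) *\<^sub>R F2 (p$1))) - D (\<lambda>q. D X q v) p u))) (at p)"
    by (rule derivative_eq_intros F_diff(1)[OF p] DX_diff[OF p] refl)+ simp
  from has_derivative_comp_nth[OF this, of i]
  have "((\<lambda>q. D (\<lambda>q. N q $ i) q v) has_derivative
     (\<lambda>u. ((1/r) *\<^sub>R (v$1 *\<^sub>R (u$1 *\<^sub>R (k1 (p$1) *\<^sub>R F2 (p$1))) - D (\<lambda>q. D X q v) p u)) $ i)) (at p)"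
    by (rule has_derivative_transform_within_open[OF _ U p]) (simp add: D1)
  from D_eqI[OF this]
  have D2: "D (\<lambda>q. D (\<lambda>q. N q $ i) q v) p u
    = ((1/r) *\<^sub>R (v$1 *\<^sub>R (u$1 *\<^sub>R (k1 (p$1) *\<^sub>R F2 (p$1))) - D (\<lambda>q. D X q v) p u)) $ i" by simp
  show ?thesis
    unfolding hessian_form_def D2 D1[OF p] LCn[OF p, of v u] LC1[OF p] HF_def
      vector_minus_component[symmetric]
    by (rule arg_cong[where f = "\<lambda>x. x $ i"]) (simp add: algebra_simps)
qed

lemma dphi_linear: "p \<in> U \<Longrightarrow> linear (D \<phi> p)"
  using phi_diff has_derivative_linear by blast

lemma linear_dn: "p \<in> U \<Longrightarrow> linear (dn p)"
  using n_deriv has_derivative_linear by blast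

lemma HF_linear: assumes p: "p \<in> U"
  shows "linear (HF p u)" "linear (\<lambda>u. HF p u v)"
proof -
  define K where "K x y z = (1/r) *\<^sub>R (x *\<^sub>R F2 (p$1) - (y / \<phi> p) *\<^sub>R F1 (p$1) + z *\<^sub>R n p)" for x y z
  have K1: "K (x + x') (y + y') (z + z') = K x y z + K x' y' z'" for x y z x' y' z'
    by (simp add: K_def add_divide_distrib scaleR_add_left scaleR_add_right scaleR_diff_right)
  have K2: "K (c * x) (c * y) (c * z) = c *\<^sub>R K x y z" for c x y z
    by (simp add: K_def scaleR_add_right scaleR_diff_right mult.commute)
  have H: "HF p u v = K (u$1 * v$1 * k1 (p$1)) (v$1 * D \<phi> p u + u$1 * k1 (p$1) * mink (D X p v) (F2 (p$1)))
     (mink (D X p v) (dn p u))" for u v by (simp add: HF_def K_def)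
  note l = linear_add[OF linear_DX[OF p]] linear_scale[OF linear_DX[OF p]]
    linear_add[OF linear_dn[OF p]] linear_scale[OF linear_dn[OF p]]
    linear_add[OF dphi_linear[OF p]] linear_scale[OF dphi_linear[OF p]] mink_simps
  show "linear (HF p u)"
    by (rule linearI) (simp_all only: H K1[symmetric] K2[symmetric] l vector_add_component vector_scaleR_component real_scaleR_def distrib_left distrib_right ac_simps)
  show "linear (\<lambda>u. HF p u v)"
    by (rule linearI) (simp_all only: H K1[symmetric] K2[symmetric] l vector_add_component vector_scaleR_component real_scaleR_def distrib_left distrib_right ac_simps)
qed

lemma cheng_yau_tube: assumes p: "p \<in> U"
    and h: "\<And>u v. hessian_form X f p u v = h u v"
    and l1: "\<And>u. linear (h u)" and l2: "\<And>v. linear (\<lambda>u. h u v)"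
  shows "cheng_yau X N 1 f p = 2 / (r * (\<phi> p)^2) * h (e0 p) (e0 p)
    - (1/r + \<kappa>3 p) * (h (axis 2 1) (axis 2 1) / (r * cos (p$3))^2 + h (axis 3 1) (axis 3 1) / r^2)"
proof -
  have H: "hessian_operator X f p u = sharp p (h u)" for u
    unfolding hessian_operator_def h by (rule the_sharp[OF p l1])
  have N1: "newton X N 1 p u = (- (1/r + \<kappa>3 p)) *\<^sub>R u + (u$1 * (\<kappa>3 p - 1/r)) *\<^sub>R e0 p" for u
  proof -
    define \<rho> where "\<rho> = 1/r"
    have c: "curv_coeff X N (Suc 0) p = - (\<rho> + \<rho> + \<kappa>3 p)" using coeffs(1)[OF p] by (simp add: \<rho>_def)
    show ?thesis
      unfolding \<rho>_def[symmetric] by (simp add: c shape[OF p, folded \<rho>_def] vec_eq_iff algebra_simps)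
  qed
  have e: "e0 p = axis 1 1 - a p *\<^sub>R axis 2 1 - b p *\<^sub>R axis 3 1"
    by (simp add: vec_eq_iff forall_3 axis_def)
  have x: "h (e0 p) (e0 p) = h (axis 1 1) (e0 p) - a p * h (axis 2 1) (e0 p) - b p * h (axis 3 1) (e0 p)"
    using linear_diff[OF l2] linear_scale[OF l2] by (subst e) (simp)
  have c: "sharp p k $ 1 = - k (e0 p) / (\<phi> p)^2"
    "sharp p k $ 2 = a p * k (e0 p) / (\<phi> p)^2 + k (axis 2 1) / (r * cos (p$3))^2"
    "sharp p k $ 3 = b p * k (e0 p) / (\<phi> p)^2 + k (axis 3 1) / r^2" for k
    by (simp_all add: sharp_def axis_def)
  have "cheng_yau X N 1 f p =
     (\<Sum>i\<in>UNIV. - (1/r + \<kappa>3 p) * sharp p (h (axis i 1)) $ i + (\<kappa>3 p - 1/r) * (sharp p (h (axis i 1)) $ 1) * e0 p $ i)"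
    unfolding cheng_yau_def trace_def matrix_def N1 H by (simp add: algebra_simps)
  also have "\<dots> = - (1/r + \<kappa>3 p) * (- h (e0 p) (e0 p) / (\<phi> p)^2 + h (axis 2 1) (axis 2 1) / (r * cos (p$3))^2 + h (axis 3 1) (axis 3 1) / r^2)
      + (\<kappa>3 p - 1/r) * (- h (e0 p) (e0 p) / (\<phi> p)^2)"
    unfolding sum_3 c e0_nth x by (simp add: algebra_simps add_divide_distrib diff_divide_distrib)
  also have "\<dots> = 2 / (r * (\<phi> p)^2) * h (e0 p) (e0 p)
    - (1/r + \<kappa>3 p) * (h (axis 2 1) (axis 2 1) / (r * cos (p$3))^2 + h (axis 3 1) (axis 3 1) / r^2)"
    using r ph[OF p] by (simp add: field_simps)
  finally show ?thesis .
qed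

lemma HF_vals: assumes p: "p \<in> U"
  shows "HF p (e0 p) (e0 p) = (1/r) *\<^sub>R (k1 (p$1) *\<^sub>R F2 (p$1) - (D \<phi> p (e0 p) / \<phi> p) *\<^sub>R F1 (p$1)
      - (\<phi> p * k1 (p$1) * cos (p$2) * cos (p$3)) *\<^sub>R n p)"
    "HF p (axis 2 1) (axis 2 1) = (cos (p$3))^2 *\<^sub>R n p"
    "HF p (axis 3 1) (axis 3 1) = n p"
  using r by (simp_all add: HF_def DX_eq[OF p] dn_eq[OF p] mink_simps fr[OF p] ip[OF p] axis_def)

lemma L1N: assumes p: "p \<in> U"
  shows "cheng_yau_vec X N 1 N p = (2 / (r * (\<phi> p)^2)) *\<^sub>R HF p (e0 p) (e0 p) - (2 * (1/r + \<kappa>3 p) / r^2) *\<^sub>R n p"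
proof -
  have "cheng_yau X N 1 (\<lambda>q. N q $ i) p = 2 / (r * (\<phi> p)^2) * HF p (e0 p) (e0 p) $ i
    - (1/r + \<kappa>3 p) * (HF p (axis 2 1) (axis 2 1) $ i / (r * cos (p$3))^2 + HF p (axis 3 1) (axis 3 1) $ i / r^2)" for i
    by (rule cheng_yau_tube[OF p hess[OF p]]; rule linearI)
      (simp_all add: linear_add[OF HF_linear(1)[OF p]] linear_scale[OF HF_linear(1)[OF p]]
        linear_add[OF HF_linear(2)[OF p]] linear_scale[OF HF_linear(2)[OF p]])
  then show ?thesis
    using cw[OF p] r by (simp add: vec_eq_iff cheng_yau_vec_def HF_vals(2,3)[OF p] power_mult_distrib field_simps)
qed

lemma grad: assumes p: "p \<in> U"
  shows "D X p (gradient X (mean_curv X N 2) p) = (2 / (3 * r^2 * (\<phi> p)^2)) *\<^sub>R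
    (- (D \<phi> p (e0 p) / \<phi> p) *\<^sub>R F1 (p$1) - (k1 (p$1) * sin (p$2) / cos (p$3)) *\<^sub>R nt p
      - (k1 (p$1) * cos (p$2) * sin (p$3)) *\<^sub>R nw p)"
proof -
  have aux: "((\<lambda>q. C - m * inverse (\<phi> q)) has_derivative
      (\<lambda>u. m * (inverse (\<phi> p) * D \<phi> p u * inverse (\<phi> p)))) (at p)" for C m
    using has_derivative_diff[OF has_derivative_const
        has_derivative_mult_right[OF Deriv.has_derivative_inverse[OF ph[OF p] phi_diff[OF p]]]]
    by simp
  have "((\<lambda>q. 1/r^2 - 2 / (3 * r^2) * inverse (\<phi> q)) has_derivative
      (\<lambda>u. 2 / (3 * r^2) * (inverse (\<phi> p) * D \<phi> p u * inverse (\<phi> p)))) (at p)"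
    by (rule aux)
  also have "(\<lambda>u. 2 / (3 * r^2) * (inverse (\<phi> p) * D \<phi> p u * inverse (\<phi> p))) =
      (\<lambda>u. 2 / (3 * r^2 * (\<phi> p)^2) * D \<phi> p u)"
    by (simp add: fun_eq_iff inverse_eq_divide power2_eq_square)
  finally have "((\<lambda>q. 1/r^2 - 2 / (3 * r^2) * inverse (\<phi> q)) has_derivative
      (\<lambda>u. 2 / (3 * r^2 * (\<phi> p)^2) * D \<phi> p u)) (at p)" .
  then have "(mean_curv X N 2 has_derivative (\<lambda>u. 2 / (3 * r^2 * (\<phi> p)^2) * D \<phi> p u)) (at p)"
  proof (rule has_derivative_transform_within_open[OF _ U p])
    fix q assume q: "q \<in> U"
    have "\<kappa>3 q = (1/r) * (1 - inverse (\<phi> q))"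
    proof -
      have "k1 (q$1) * cos (q$2) * cos (q$3) = (\<phi> q - 1) / r" using r by (simp add: \<phi>_def)
      then show ?thesis using ph[OF q] r unfolding \<kappa>3_def by (simp add: field_simps)
    qed
    then show "1/r^2 - 2 / (3 * r^2) * inverse (\<phi> q) = mean_curv X N 2 q"
    proof -
      have "1/r^2 - 2 / (3 * r^2) * x = (1/r^2 + 2 * ((1/r) * (1 - x)) / r) / 3" for x
        using r by (simp add: power2_eq_square field_simps)
      moreover assume "\<kappa>3 q = (1/r) * (1 - inverse (\<phi> q))"
      ultimately show ?thesis unfolding means(2)[OF q] by (simp only:)
    qed
  qed
  from D_eqI[OF this] have d: "D (mean_curv X N 2) p v = 2 / (3 * r^2 * (\<phi> p)^2) * D \<phi> p v" for v by simp
  have l: "linear (\<lambda>v. 2 / (3 * r^2 * (\<phi> p)^2) * D \<phi> p v)"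
    by (rule linearI) (simp_all add: linear_add[OF dphi_linear[OF p]] linear_scale[OF dphi_linear[OF p]] algebra_simps add_divide_distrib)
  define m where "m = 2 / (3 * r^2 * (\<phi> p)^2)"
  have g: "gradient X (mean_curv X N 2) p = sharp p (\<lambda>v. m * D \<phi> p v)"
    unfolding gradient_def d m_def by (rule the_sharp[OF p l])
  have "D X p (gradient X (mean_curv X N 2) p) = m *\<^sub>R
    (- (D \<phi> p (e0 p) / \<phi> p) *\<^sub>R F1 (p$1) - (k1 (p$1) * sin (p$2) / cos (p$3)) *\<^sub>R nt p
      - (k1 (p$1) * cos (p$2) * sin (p$3)) *\<^sub>R nw p)"
  proof -
    let ?s = "sharp p (\<lambda>v. m * D \<phi> p v)"
    have s: "?s $ 1 = - (m * D \<phi> p (e0 p)) / (\<phi> p)^2"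
      "?s $ 2 + a p * ?s $ 1 = m * D \<phi> p (axis 2 1) / (r * cos (p$3))^2"
      "?s $ 3 + b p * ?s $ 1 = m * D \<phi> p (axis 3 1) / r^2"
    proof -
      have ax: "axis i (1::real) $ j = (if j = i then 1 else 0)" for i j :: 3 by (simp add: axis_def)
      show "?s $ 1 = - (m * D \<phi> p (e0 p)) / (\<phi> p)^2"
        "?s $ 2 + a p * ?s $ 1 = m * D \<phi> p (axis 2 1) / (r * cos (p$3))^2"
        "?s $ 3 + b p * ?s $ 1 = m * D \<phi> p (axis 3 1) / r^2"
        unfolding sharp_def by (simp_all add: ax)
    qed
    have c: "\<phi> p * ?s $ 1 = - (m * (D \<phi> p (e0 p) / \<phi> p))"
      "r * (?s $ 2 + a p * ?s $ 1) = - (m * (k1 (p$1) * sin (p$2) / cos (p$3)))"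
      "r * (?s $ 3 + b p * ?s $ 1) = - (m * (k1 (p$1) * cos (p$2) * sin (p$3)))"
    proof -
      show "\<phi> p * ?s $ 1 = - (m * (D \<phi> p (e0 p) / \<phi> p))"
        unfolding s(1) using ph[OF p] by (simp add: power2_eq_square)
      show "r * (?s $ 2 + a p * ?s $ 1) = - (m * (k1 (p$1) * sin (p$2) / cos (p$3)))"
        unfolding s(2) phi_tw[OF p] using r cw[OF p] by (simp add: power2_eq_square)
      show "r * (?s $ 3 + b p * ?s $ 1) = - (m * (k1 (p$1) * cos (p$2) * sin (p$3)))"
        unfolding s(3) phi_tw[OF p] using r by (simp add: power2_eq_square)
    qed
    show ?thesis unfolding g DX_eq[OF p] c by (simp add: scaleR_diff_right)
  qed
  then show ?thesis by (simp add: m_def)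
qed

lemma formula: assumes p: "p \<in> U"
  shows "cheng_yau_vec X N 1 N p = 3 *\<^sub>R (D X p (gradient X (mean_curv X N 2) p)
    + (3 * mean_curv X N 1 p * mean_curv X N 2 p - mean_curv X N 3 p) *\<^sub>R N p)"
proof -
  define G where "G = - (D \<phi> p (e0 p) / \<phi> p) *\<^sub>R F1 (p$1) - (k1 (p$1) * sin (p$2) / cos (p$3)) *\<^sub>R nt p
      - (k1 (p$1) * cos (p$2) * sin (p$3)) *\<^sub>R nw p"
  define A where "A = k1 (p$1) * cos (p$2) * cos (p$3)"
  have A: "A = (\<phi> p - 1) / r" and K: "\<kappa>3 p = A / \<phi> p" using r by (simp_all add: \<phi>_def \<kappa>3_def A_def)
  have "k1 (p$1) *\<^sub>R F2 (p$1) = A *\<^sub>R n p - (k1 (p$1) * sin (p$2) / cos (p$3)) *\<^sub>R nt p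
      - (k1 (p$1) * cos (p$2) * sin (p$3)) *\<^sub>R nw p"
    by (subst F_from_n(1)[OF p]) (simp add: A_def scaleR_diff_right mult.assoc)
  then have hf: "HF p (e0 p) (e0 p) = (1/r) *\<^sub>R (G + (A - \<phi> p * A) *\<^sub>R n p)"
  proof -
    assume k: "k1 (p$1) *\<^sub>R F2 (p$1) = A *\<^sub>R n p - (k1 (p$1) * sin (p$2) / cos (p$3)) *\<^sub>R nt p
      - (k1 (p$1) * cos (p$2) * sin (p$3)) *\<^sub>R nw p"
    have f: "\<phi> p * k1 (p$1) * cos (p$2) * cos (p$3) = \<phi> p * A" by (simp add: A_def)
    show ?thesis unfolding HF_vals(1)[OF p] k f G_def by (simp add: scaleR_diff_left)
  qed
  have m: "2 / (r * (\<phi> p)^2) * (1/r) = 2 / (r^2 * (\<phi> p)^2)" by (simp add: power2_eq_square)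
  have L: "cheng_yau_vec X N 1 N p = (2 / (r^2 * (\<phi> p)^2)) *\<^sub>R G
     + (2 / (r^2 * (\<phi> p)^2) * (A - \<phi> p * A) - 2 * (1/r + \<kappa>3 p) / r^2) *\<^sub>R n p"
  proof -
    have "y *\<^sub>R (g + x *\<^sub>R v) - c *\<^sub>R v = y *\<^sub>R g + (y * x - c) *\<^sub>R v" for y x c and g v :: "real^4"
      by (simp add: algebra_simps)
    then show ?thesis unfolding L1N[OF p] hf scaleR_scaleR m .
  qed
  have c: "2 / (r^2 * (\<phi> p)^2) * (A - \<phi> p * A) - 2 * (1/r + \<kappa>3 p) / r^2
    = - (3 * (3 * mean_curv X N 1 p * mean_curv X N 2 p - mean_curv X N 3 p))"
    unfolding means[OF p] K A using r ph[OF p] by (simp add: field_simps power2_eq_square)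
  show ?thesis
  proof -
    have "(2 / (r^2 * (\<phi> p)^2)) = 3 * (2 / (3 * r^2 * (\<phi> p)^2))" by simp
    moreover have "(3 * x) *\<^sub>R g + (- (3 * y)) *\<^sub>R v = 3 *\<^sub>R (x *\<^sub>R g + y *\<^sub>R (- v))" for x y and g v :: "real^4"
      by (simp add: algebra_simps)
    ultimately show ?thesis
      unfolding L c grad[OF p] G_def[symmetric] tube_normal_def by (simp only:)
  qed
qed

end

theorem cheng_yau_gauss_map:
  fixes r :: real and p :: "real^3"
  assumes "r > 0" and "timelike_frenet_curve I \<beta> F1 F2 F3 F4 k1 k2 k3"
    and "open U" and "(\<lambda>p. p$1) ` U = I" and "immersion_on U (tube r \<beta> F2 F3 F4)" and "p \<in> U"
  defines "X \<equiv> tube r \<beta> F2 F3 F4" and "N \<equiv> tube_normal F2 F3 F4"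
  defines "\<epsilon> \<equiv> mink (N p) (N p)"
  shows "cheng_yau_vec X N 1 N p = - (\<epsilon> * (real (3 choose 2) * - \<epsilon>)) *\<^sub>R
    (D X p (gradient X (mean_curv X N 2) p)
      + (3 * mean_curv X N 1 p * mean_curv X N 2 p - mean_curv X N 3 p) *\<^sub>R N p)"
proof -
  interpret frenet_tube r I U \<beta> F1 F2 F3 F4 k1 k2 k3
    using assms(1-5) by unfold_locales
  have "\<epsilon> = 1" unfolding \<epsilon>_def N_def by (rule NN[OF \<open>p \<in> U\<close>])
  then show ?thesis
    unfolding X_def N_def formula[OF \<open>p \<in> U\<close>] by (simp add: choose_two)
qed

end

(* By cheng_yau_gauss_map, L_1 N is a multiple of grad H_2 + (3 H_1 H_2 - H_3) N, whose two
   summands are orthogonal and must therefore both vanish. The component of grad H_2 along the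
   t-direction is a nonzero multiple of k_1 sin t, and sin t is nonzero somewhere on any open
   set, so k_1 = 0 at such a point. There the third principal curvature vanishes, and
   3 H_1 H_2 - H_3 = 2/(3 r^3) is nonzero. *)
theory Submission
  imports Defs
begin

text \<open>Zeros of \<open>sin\<close> are \<open>pi\<close> apart, so from a zero a shift shorter
  than \<open>pi\<close> along axis \<open>i\<close> reaches a nonzero value inside a small
  ball.\<close>

lemma open_exists_sin_nonzero:
  fixes U :: "(real^'n) set"
  assumes "open U" and "U \<noteq> {}"
  obtains p where "p \<in> U" and "sin (p$i) \<noteq> 0"
proof -
  obtain p where p: "p \<in> U" using assms(2) by blast
  show thesis
  proof (cases "sin (p$i) = 0")
    case True
    obtain e where e: "e > 0" "cball p e \<subseteq> U"
      using assms(1) p open_contains_cball by blast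
    \<comment> \<open>The cap 1 keeps \<open>d\<close> below \<open>pi\<close>, so that
      \<open>sin d > 0\<close>.\<close>
    define d where "d = min e 1"
    have d: "0 < d" "d \<le> e" "d < pi" using e(1) pi_gt3 by (auto simp: d_def)
    have "p + d *\<^sub>R axis i 1 \<in> U"
      using e(2) d by (auto simp: dist_norm subset_iff)
    moreover have "cos (p$i) \<noteq> 0"
      using True sin_cos_squared_add[of "p$i"] by auto
    then have "sin ((p + d *\<^sub>R axis i 1)$i) \<noteq> 0"
      using True sin_gt_zero[OF d(1) d(3)] by (simp add: axis_def sin_add)
    ultimately show thesis by (rule that)
  qed (use p that in blast)
qed

context frenet_tube
begin

text \<open>Among the orthogonal vectors \<open>F1\<close>, \<open>nt\<close>, \<open>nw\<close>
  only \<open>nt\<close> contributes; its square \<open>(cos (p$3))^2\<close> cancels the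
  denominator in \<open>grad\<close>.\<close>

lemma mink_gradient_mean_curv_2:
  assumes p: "p \<in> U"
  shows "mink (D X p (gradient X (mean_curv X N 2) p)) (nt p)
    = - (2 / (3 * r^2 * (\<phi> p)^2)) * k1 (p$1) * sin (p$2) * cos (p$3)"
  using cw[OF p] by (simp add: grad[OF p] mink_simps ip[OF p] power2_eq_square)

lemma cheng_yau_gauss_map_zeroD:
  assumes p: "p \<in> U" and zero: "cheng_yau_vec X N 1 N p = 0"
  shows "k1 (p$1) * sin (p$2) = 0"
    and "3 * mean_curv X N 1 p * mean_curv X N 2 p = mean_curv X N 3 p"
proof -
  let ?G = "D X p (gradient X (mean_curv X N 2) p)"
  let ?c = "3 * mean_curv X N 1 p * mean_curv X N 2 p - mean_curv X N 3 p"
  have sum: "?G + ?c *\<^sub>R N p = 0"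
    using zero unfolding formula[OF p] by simp
  have "mink (?G + ?c *\<^sub>R N p) (nt p) = mink ?G (nt p)"
    by (simp add: tube_normal_def mink_simps ip[OF p])
  then have "mink ?G (nt p) = 0" unfolding sum by (simp add: mink_simps)
  \<comment> \<open>The remaining factors are nonzero: \<open>\<phi> p\<close> and
    \<open>cos (p$3)\<close> by immersion.\<close>
  then show "k1 (p$1) * sin (p$2) = 0"
    unfolding mink_gradient_mean_curv_2[OF p] using r ph[OF p] cw[OF p] by simp
  \<comment> \<open>\<open>?G\<close> is tangent, and \<open>n p\<close> is the unit vector
    \<open>- N p\<close>.\<close>
  have "mink (?G + ?c *\<^sub>R N p) (n p) = - ?c"
    by (simp add: tube_normal_def DX_eq[OF p] mink_simps ip[OF p])
  then show "3 * mean_curv X N 1 p * mean_curv X N 2 p = mean_curv X N 3 p"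
    unfolding sum by (simp add: mink_simps)
qed

end

theorem theorem4:
  fixes r :: real and I :: "real set" and U :: "(real^3) set"
    and \<beta> F1 F2 F3 F4 :: "real \<Rightarrow> real^4" and k1 k2 k3 :: "real \<Rightarrow> real"
  assumes "r > 0"
    and "timelike_frenet_curve I \<beta> F1 F2 F3 F4 k1 k2 k3"
    and "open U" and "connected U" and "U \<noteq> {}"
    and "(\<lambda>p. p$1) ` U = I"
    and "immersion_on U (tube r \<beta> F2 F3 F4)"
  shows "\<not> (\<forall>p\<in>U. cheng_yau_vec (tube r \<beta> F2 F3 F4) (tube_normal F2 F3 F4) 1
                     (tube_normal F2 F3 F4) p = 0)"
proof
  interpret frenet_tube r I U \<beta> F1 F2 F3 F4 k1 k2 k3
    using assms by unfold_locales
  assume zero: "\<forall>p\<in>U. cheng_yau_vec X N 1 N p = 0"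
  obtain p where p: "p \<in> U" and "sin (p$2) \<noteq> 0"
    using open_exists_sin_nonzero[OF \<open>open U\<close> \<open>U \<noteq> {}\<close>] .
  note z = cheng_yau_gauss_map_zeroD[OF p zero[rule_format, OF p]]
  have "\<kappa>3 p = 0" using z(1) \<open>sin (p$2) \<noteq> 0\<close> by (simp add: \<kappa>3_def)
  \<comment> \<open>Here \<open>means\<close> gives H_1 = 2/(3r), H_2 = 1/(3r^2), H_3 = 0.\<close>
  then show False using z(2) \<open>r > 0\<close> unfolding means[OF p] by simp
qed

end
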